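(* Fix an expert $i$ and attribute $j$, let $K_{ij}\ge1$, and let $\mathcal P_{ij}\subset\mathbb R^{K_{ij}}$ be the set of utility vectors satisfying a given partial preference context. Let $\bar V(r)=1/K_{ij}$ for $r\in[K_{ij}]$ be the uniformly weighted utility. Then maximum entropy utility is the special case of minimum cross-entropy utility with uniformly weighted target utility: $$\underset{\mathbf U_{ij}\in\mathcal P_{ij}}{\arg\max}\ -\sum_{r=1}^{K_{ij}}U_{ij}(r)\ln U_{ij}(r)\;=\;\underset{\mathbf U_{ij}\in\mathcal P_{ij}}{\arg\min}\ \sum_{r=1}^{K_{ij}}U_{ij}(r)\ln\frac{U_{ij}(r)}{\bar V(r)}.$$
   Context: $[n]=\{1,\dots,n\}$; $0\ln0=0$. The partial preference context $\mathcal P_{ij}$ is the set of $\mathbf U_{ij}=(U_{ij}(r))_{r\in[K_{ij}]}$ satisfying all of the following (the first three families are finite, possibly empty, with given constants and given ranks): ratio scales: $U_{ij}(r_{e})=\alpha_{e}U_{ij}(r_{e}+1)$ for $e\in[E_1]$, with given $r_e\in[K_{ij}-1]$; absolute differences: $U_{ij}(r_{e})-U_{ij}(r_{e}+1)=\beta_{e}$ for $e\in[E_2]$, with given $r_e\in[K_{ij}-1]$; lower bounds: $U_{ij}(r_{e})\ge\gamma_{e}\ge0$ for $e\in[E_3]$, with given $r_e\in[K_{ij}]$; weak order: $U_{ij}(r)\ge U_{ij}(r+1)$ for $r\in[K_{ij}-1]$; normalization: $\sum_{r=1}^{K_{ij}}U_{ij}(r)=1$; non-negativity: $U_{ij}(r)\ge0$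 for $r\in[K_{ij}]$. (The ranks $r_e$ may differ between families.) *)

theory Defs
  imports "HOL-Analysis.Analysis"
begin

text \<open>
  A vector in the Euclidean space of dimension \<open>K\<close> is a function on the ranks
  \<open>{1..K}\<close>, taken as an element of \<open>{1..K} \<rightarrow>\<^sub>E UNIV\<close>, so that equality of such
  functions is equality of vectors.
\<close>

text \<open>
  The indices of the three families of constraints range over \<open>{1..ratio_count C}\<close>,
  \<open>{1..diff_count C}\<close> and \<open>{1..bound_count C}\<close>; values of the other fields at other
  indices play no role.
\<close>

record preference_context =
  ratio_count :: nat
  ratio_rank :: "nat \<Rightarrow> nat"
  ratio_const :: "nat \<Rightarrow> real"
  diff_count :: nat
  diff_rank :: "nat \<Rightarrow> nat"
  diff_const :: "nat \<Rightarrow> real"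
  bound_count :: nat
  bound_rank :: "nat \<Rightarrow> nat"
  bound_const :: "nat \<Rightarrow> real"

definition wf_preference_context :: "nat \<Rightarrow> preference_context \<Rightarrow> bool" where
  "wf_preference_context K C \<longleftrightarrow>
     (\<forall>e\<in>{1..ratio_count C}. ratio_rank C e \<in> {1..K - 1}) \<and>
     (\<forall>e\<in>{1..diff_count C}. diff_rank C e \<in> {1..K - 1}) \<and>
     (\<forall>e\<in>{1..bound_count C}. bound_rank C e \<in> {1..K} \<and> bound_const C e \<ge> 0)"

definition utility_vectors :: "nat \<Rightarrow> preference_context \<Rightarrow> (nat \<Rightarrow> real) set" where
  "utility_vectors K C =
     {U \<in> {1..K} \<rightarrow>\<^sub>E UNIV.
        (\<forall>e\<in>{1..ratio_count C}.
           U (ratio_rank C e) = ratio_const C e * U (ratio_rank C e + 1)) \<and>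
        (\<forall>e\<in>{1..diff_count C}.
           U (diff_rank C e) - U (diff_rank C e + 1) = diff_const C e) \<and>
        (\<forall>e\<in>{1..bound_count C}. U (bound_rank C e) \<ge> bound_const C e) \<and>
        (\<forall>r\<in>{1..K - 1}. U r \<ge> U (r + 1)) \<and>
        (\<Sum>r=1..K. U r) = 1 \<and>
        (\<forall>r\<in>{1..K}. U r \<ge> 0)}"

text \<open>
  The convention \<open>0 ln 0 = 0\<close> holds in the next two definitions because a product with
  factor \<open>0\<close> is \<open>0\<close>, whatever the value of \<^const>\<open>ln\<close> at \<open>0\<close>.
\<close>

definition entropy :: "nat \<Rightarrow> (nat \<Rightarrow> real) \<Rightarrow> real" where
  "entropy K U = - (\<Sum>r=1..K. U r * ln (U r))"

definition cross_entropy :: "nat \<Rightarrow> (nat \<Rightarrow> real) \<Rightarrow> (nat \<Rightarrow> real) \<Rightarrow> real" where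
  "cross_entropy K V U = (\<Sum>r=1..K. U r * ln (U r / V r))"

definition max_entropy_utilities :: "nat \<Rightarrow> preference_context \<Rightarrow> (nat \<Rightarrow> real) set" where
  "max_entropy_utilities K C =
     {U. is_arg_max (entropy K) (\<lambda>W. W \<in> utility_vectors K C) U}"

definition min_cross_entropy_utilities ::
    "nat \<Rightarrow> (nat \<Rightarrow> real) \<Rightarrow> preference_context \<Rightarrow> (nat \<Rightarrow> real) set" where
  "min_cross_entropy_utilities K V C =
     {U. is_arg_min (cross_entropy K V) (\<lambda>W. W \<in> utility_vectors K C) U}"

definition uniform_utility :: "nat \<Rightarrow> nat \<Rightarrow> real" where
  "uniform_utility K = (\<lambda>r\<in>{1..K}. 1 / real K)"

end

theory Submission
  imports Defs
begin

text \<open>Dividing by the uniform weight 1/K adds \<open>ln K\<close> to every logarithm. Weighted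
  by a utility vector of total mass 1, these additions sum to the constant \<open>ln K\<close>, so
  on the feasible set cross-entropy is \<open>ln K\<close> minus entropy
  (\<open>cross_entropy_uniform_utility\<close>). A constant minus a function is smallest exactly
  where the function is largest.\<close>

lemma cross_entropy_uniform_utility:
  assumes "K \<ge> 1" and "\<And>r. r \<in> {1..K} \<Longrightarrow> U r \<ge> 0" and "(\<Sum>r=1..K. U r) = 1"
  shows "cross_entropy K (uniform_utility K) U = ln (real K) - entropy K U"
proof -
  have "U r * ln (U r / uniform_utility K r) = U r * ln (U r) + U r * ln (real K)"
    if "r \<in> {1..K}" for r
  \<comment> \<open>The logarithm splits over the product \<open>U r * K\<close> only for positive
    \<open>U r\<close>; at 0 the factor \<open>U r\<close> makes both sides vanish.\<close>
  proof (cases "U r = 0")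
    case False
    with assms(2)[OF that] have "U r > 0" by simp
    with \<open>K \<ge> 1\<close> that show ?thesis
      by (simp add: uniform_utility_def ln_mult distrib_left)
  qed simp
  then have "cross_entropy K (uniform_utility K) U =
      (\<Sum>r=1..K. U r * ln (U r) + U r * ln (real K))"
    unfolding cross_entropy_def by (intro sum.cong refl)
  also have "\<dots> = (\<Sum>r=1..K. U r * ln (U r)) + (\<Sum>r=1..K. U r) * ln (real K)"
    by (simp add: sum.distrib sum_distrib_right)
  finally show ?thesis
    using assms(3) by (simp add: entropy_def)
qed

theorem theorem3:
  fixes K :: nat and C :: preference_context
  assumes "K \<ge> 1"
    and "wf_preference_context K C"
  shows "max_entropy_utilities K C = min_cross_entropy_utilities K (uniform_utility K) C"
proof -
  have "cross_entropy K (uniform_utility K) U = ln (real K) - entropy K U"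
    if "U \<in> utility_vectors K C" for U
    using that \<open>K \<ge> 1\<close>
    by (intro cross_entropy_uniform_utility) (auto simp: utility_vectors_def)
  \<comment> \<open>Both optimality predicates say that no feasible vector is strictly better, and
    the identity turns one strict inequality into the other. No optimum has to exist: the two sets
    may both be empty.\<close>
  then show ?thesis
    by (auto simp: max_entropy_utilities_def min_cross_entropy_utilities_def
        is_arg_max_def is_arg_min_def)
qed

end
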